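(* There is an absolute constant $c>0$ such that for every $n\ge1$ and every monotone Boolean function $f:\{0,1\}^n\to\{0,1\}$, $\mathsf{EC}(f)\ge c\cdot \mathsf{KW}^+(f)$; that is, $\mathsf{EC}(f)=\Omega(\mathsf{KW}^+(f))$.
   Context: A Boolean circuit $C$ over the basis $\mathcal{B}=\{\land_2,\lor_2,\lnot\}$ (AND and OR of fan-in 2, and NOT) is a directed acyclic graph with a root node of out-degree zero, input gates (in-degree zero) labeled by variables $x_1,\dots,x_n$, and non-input gates (including the root) labeled by functions in $\mathcal{B}$. For $a\in\{0,1\}^n$, $\mathsf{EC}(C,a)$ is the number of non-input gates of $C$ that output $1$ on $a$; $\mathsf{EC}(C)=\max_a\mathsf{EC}(C,a)$; $\mathsf{EC}(f)$ is the minimum of $\mathsf{EC}(C)$ over all (not necessarily monotone) circuits $C$ over $\mathcal{B}$ computing $f$. $f$ is monotone if $x_i\le y_i$ for all $i$ implies $f(x)\le f(y)$. For a monotone $f$, the monotone Karchmer-Wigderson game is the two-party communication problem in which Alice holds $x\in f^{-1}(1)$, Bob holds $y\in f^{-1}(0)$, and they must agree on an index $i$ with $x_i=1$ and $y_i=0$. $\mathsf{KW}^+(f)$ is the optimal deterministic (worst-case) communication cost of this problem ($0$ if $f$ is constant); it equals the minimum depth of a monotone fan-in-2 Boolean circuit computing $f$ when $f$ is non-constant. *)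

theory Defs
  imports Complex_Main "HOL-Library.FuncSet"
begin

text \<open>The variables \<open>x\<^sub>1, \<dots>, x\<^sub>n\<close> are indexed by \<open>0, \<dots>, n - 1\<close>, and \<open>{0, 1}\<close> is \<open>bool\<close> with
  \<open>False \<le> True\<close>. Points of the cube are extensional, i.e. they all agree outside \<open>{..<n}\<close>, so
  \<open>x \<le> y\<close> on the cube is the coordinatewise order, the cube is finite, and
  monotonicity of \<open>f\<close> is \<open>mono_on (cube n) f\<close>.\<close>

definition cube :: "nat \<Rightarrow> (nat \<Rightarrow> bool) set" where
  "cube n = {..<n} \<rightarrow>\<^sub>E UNIV"

subsection \<open>Boolean circuits and energy complexity\<close>

text \<open>Nodes are named by natural numbers; every finite DAG is isomorphic to one of this kind. The
  label of a node records the function it computes together with the nodes feeding it. Several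
  input gates may carry the same variable, and both arguments of a binary gate may be the same
  node.\<close>

datatype gate = Input nat | And nat nat | Or nat nat | Not nat

fun args :: "gate \<Rightarrow> nat set" where
  "args (Input i) = {}"
| "args (And u v) = {u, v}"
| "args (Or u v) = {u, v}"
| "args (Not u) = {u}"

record circuit =
  nodes :: "nat set"
  label :: "nat \<Rightarrow> gate"
  root :: nat

definition wires :: "circuit \<Rightarrow> (nat \<times> nat) set" where
  "wires C = {(u, v). v \<in> nodes C \<and> u \<in> args (label C v)}"

definition input_gates :: "circuit \<Rightarrow> nat set" where
  "input_gates C = {v \<in> nodes C. \<exists>i. label C v = Input i}"

definition is_circuit :: "nat \<Rightarrow> circuit \<Rightarrow> bool" where
  "is_circuit n C \<longleftrightarrow>
     finite (nodes C) \<and>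
     wires C \<subseteq> nodes C \<times> nodes C \<and>
     acyclic (wires C) \<and>
     (\<forall>v \<in> nodes C. \<forall>i. label C v = Input i \<longrightarrow> i < n) \<and>
     root C \<in> nodes C - input_gates C \<and>
     root C \<notin> Domain (wires C)"

text \<open>\<open>outputs C a v b\<close>: gate \<open>v\<close> of \<open>C\<close> has value \<open>b\<close> on input \<open>a\<close>. Since \<open>C\<close> is finite and
  acyclic, every node has exactly one value.\<close>

inductive outputs :: "circuit \<Rightarrow> (nat \<Rightarrow> bool) \<Rightarrow> nat \<Rightarrow> bool \<Rightarrow> bool"
  for C :: circuit and a :: "nat \<Rightarrow> bool" where
  Input: "label C v = Input i \<Longrightarrow> outputs C a v (a i)"
| And: "label C v = And u w \<Longrightarrow> outputs C a u p \<Longrightarrow> outputs C a w q \<Longrightarrow> outputs C a v (p \<and> q)"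
| Or: "label C v = Or u w \<Longrightarrow> outputs C a u p \<Longrightarrow> outputs C a w q \<Longrightarrow> outputs C a v (p \<or> q)"
| Not: "label C v = Not u \<Longrightarrow> outputs C a u p \<Longrightarrow> outputs C a v (\<not> p)"

definition computes :: "nat \<Rightarrow> circuit \<Rightarrow> ((nat \<Rightarrow> bool) \<Rightarrow> bool) \<Rightarrow> bool" where
  "computes n C f \<longleftrightarrow> (\<forall>a \<in> cube n. outputs C a (root C) (f a))"

definition EC_at :: "circuit \<Rightarrow> (nat \<Rightarrow> bool) \<Rightarrow> nat" where
  "EC_at C a = card {v \<in> nodes C - input_gates C. outputs C a v True}"

definition EC_circuit :: "nat \<Rightarrow> circuit \<Rightarrow> nat" where
  "EC_circuit n C = Max (EC_at C ` cube n)"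

text \<open>For \<open>n \<ge> 1\<close> every Boolean function is computed by some circuit, so this infimum is a
  minimum. (For \<open>n = 0\<close> there are no input gates, hence no circuits, and the value is a dummy 0.)\<close>

definition EC :: "nat \<Rightarrow> ((nat \<Rightarrow> bool) \<Rightarrow> bool) \<Rightarrow> nat" where
  "EC n f = (INF C \<in> {C. is_circuit n C \<and> computes n C f}. EC_circuit n C)"

subsection \<open>The monotone Karchmer-Wigderson game\<close>

text \<open>A deterministic protocol is a binary tree: at each inner node its owner sends one bit, a
  function of the owner's input, and play continues in the first subtree if the bit is 1 and in the
  second one otherwise. A leaf carries the answer, which is thereby known to both players. The cost
  of a protocol is the height of its tree.\<close>

datatype protocol =
    Answer nat
  | Alice "(nat \<Rightarrow> bool) \<Rightarrow> bool" protocol protocol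
  | Bob "(nat \<Rightarrow> bool) \<Rightarrow> bool" protocol protocol

fun run :: "protocol \<Rightarrow> (nat \<Rightarrow> bool) \<Rightarrow> (nat \<Rightarrow> bool) \<Rightarrow> nat" where
  "run (Answer i) x y = i"
| "run (Alice m P Q) x y = (if m x then run P x y else run Q x y)"
| "run (Bob m P Q) x y = (if m y then run P x y else run Q x y)"

fun cost :: "protocol \<Rightarrow> nat" where
  "cost (Answer i) = 0"
| "cost (Alice m P Q) = Suc (max (cost P) (cost Q))"
| "cost (Bob m P Q) = Suc (max (cost P) (cost Q))"

definition solves_KW_mono :: "nat \<Rightarrow> ((nat \<Rightarrow> bool) \<Rightarrow> bool) \<Rightarrow> protocol \<Rightarrow> bool" where
  "solves_KW_mono n f P \<longleftrightarrow>
     (\<forall>x \<in> cube n. \<forall>y \<in> cube n. f x \<and> \<not> f y \<longrightarrow>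
        (let i = run P x y in i < n \<and> x i \<and> \<not> y i))"

text \<open>For monotone \<open>f\<close> the set is nonempty (Alice may send all of \<open>x\<close>, then Bob the answer), so the
  infimum is a minimum. If \<open>f\<close> is constant there are no input pairs, so any single leaf is a
  solution and the value is 0.\<close>

definition KW_mono :: "nat \<Rightarrow> ((nat \<Rightarrow> bool) \<Rightarrow> bool) \<Rightarrow> nat" where
  "KW_mono n f = (INF P \<in> {P. solves_KW_mono n f P}. cost P)"

end

theory Submission
  imports Defs "HOL-Library.Countable"
begin

text \<open>Let \<open>C\<close> be a circuit of energy \<open>s\<close> for \<open>f\<close>, and let \<open>R\<close> consist of the root and of the nodes that feed
  NOT gates. On the all-zero input each of the latter, or a NOT gate above it, fires, so
  \<open>|R| \<le> 2s + 1\<close>. Starting from \<open>R\<close> and descending below true gates only, a player can reveal all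
  true nodes so reachable with \<open>|R| + 3s\<close> bits. Bob does this for his input \<open>y\<close>, which also reveals a
  set \<open>I\<close> of variables that are 1 in \<open>y\<close>. Alice replaces \<open>x\<close> by \<open>x \<or> I\<close>, where \<open>f\<close> is still 1 by
  monotonicity, and does the same. At the topologically first node of \<open>R\<close> where the two differ, the
  values of all negated nodes below agree, so only monotone gates matter: having made the variables
  of Bob's certificate 1, this node must be true for Alice and false for Bob. Hence some variable
  that Alice revealed is 0 in \<open>y\<close>; it is not in \<open>I\<close>, so it is 1 in \<open>x\<close>, and Bob names it.\<close>

section \<open>Every Boolean function has a circuit\<close>

datatype formula = FVar nat | FAnd formula formula | FOr formula formula | FNot formula

instance formula :: countable
  by countable_datatype

fun eval_formula :: "formula \<Rightarrow> (nat \<Rightarrow> bool) \<Rightarrow> bool" where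
  "eval_formula (FVar i) a = a i"
| "eval_formula (FAnd p q) a = (eval_formula p a \<and> eval_formula q a)"
| "eval_formula (FOr p q) a = (eval_formula p a \<or> eval_formula q a)"
| "eval_formula (FNot p) a = (\<not> eval_formula p a)"

fun subformulas :: "formula \<Rightarrow> formula set" where
  "subformulas (FVar i) = {FVar i}"
| "subformulas (FAnd p q) = insert (FAnd p q) (subformulas p \<union> subformulas q)"
| "subformulas (FOr p q) = insert (FOr p q) (subformulas p \<union> subformulas q)"
| "subformulas (FNot p) = insert (FNot p) (subformulas p)"

fun formula_gate :: "formula \<Rightarrow> gate" where
  "formula_gate (FVar i) = Input i"
| "formula_gate (FAnd p q) = And (to_nat p) (to_nat q)"
| "formula_gate (FOr p q) = Or (to_nat p) (to_nat q)"
| "formula_gate (FNot p) = Not (to_nat p)"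

text \<open>Coding subformulas by \<open>to_nat\<close> turns them into node names, and equal
  subformulas share a node. Labels are given to all codes, so every formula evaluates correctly in
  the circuit of any \<open>p\<close>.\<close>

definition formula_circuit :: "formula \<Rightarrow> circuit" where
  "formula_circuit p =
     \<lparr>nodes = to_nat ` subformulas p, label = (\<lambda>v. formula_gate (from_nat v)), root = to_nat p\<rparr>"

lemma self_subformula: "p \<in> subformulas p"
  by (cases p) auto

lemma finite_subformulas: "finite (subformulas p)"
  by (induction p) auto

lemma size_subformula: "q \<in> subformulas p \<Longrightarrow> size q \<le> size p"
  by (induction p) auto

lemma subformulas_trans: "q \<in> subformulas p \<Longrightarrow> subformulas q \<subseteq> subformulas p"
  by (induction p) auto

lemma args_formula_gate:
  assumes "u \<in> args (formula_gate q)"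
  obtains r where "u = to_nat r" "r \<in> subformulas q" "size r < size q"
  using assms by (cases q) (auto simp: self_subformula)

lemma outputs_formula_circuit: "outputs (formula_circuit p) a (to_nat q) (eval_formula q a)"
proof (induction q)
  case (FVar i)
  show ?case using outputs.Input[of "formula_circuit p" "to_nat (FVar i)" i a]
    by (simp add: formula_circuit_def)
next
  case (FAnd q r)
  then show ?case
    using outputs.And[of "formula_circuit p" "to_nat (FAnd q r)" "to_nat q" "to_nat r"]
    by (simp add: formula_circuit_def)
next
  case (FOr q r)
  then show ?case
    using outputs.Or[of "formula_circuit p" "to_nat (FOr q r)" "to_nat q" "to_nat r"]
    by (simp add: formula_circuit_def)
next
  case (FNot q)
  then show ?case
    using outputs.Not[of "formula_circuit p" "to_nat (FNot q)" "to_nat q"]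
    by (simp add: formula_circuit_def)
qed

lemma wires_formula_circuit:
  assumes "(u, v) \<in> wires (formula_circuit p)"
  obtains q r where "v = to_nat q" "u = to_nat r" "q \<in> subformulas p" "r \<in> subformulas p"
    "size r < size q"
proof -
  from assms obtain q where q: "v = to_nat q" "q \<in> subformulas p" "u \<in> args (formula_gate q)"
    by (auto simp: wires_def formula_circuit_def)
  from q(3) obtain r where "u = to_nat r" "r \<in> subformulas q" "size r < size q"
    by (rule args_formula_gate)
  with q subformulas_trans that show thesis by blast
qed

text \<open>Wires lead from smaller to larger formulas; this gives acyclicity and a root without
  outgoing wires. The hypothesis \<open>nonvar\<close> reflects that a root must be a non-input
  gate.\<close>

lemma is_circuit_formula_circuit:
  assumes vars: "\<And>i. FVar i \<in> subformulas p \<Longrightarrow> i < n" and nonvar: "\<And>i. p \<noteq> FVar i"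
  shows "is_circuit n (formula_circuit p)"
proof -
  have nodes_eq: "nodes (formula_circuit p) = to_nat ` subformulas p"
    by (simp add: formula_circuit_def)
  have "wires (formula_circuit p) \<subseteq> measure (\<lambda>v. size (from_nat v :: formula))"
    by (auto elim!: wires_formula_circuit)
  then have "acyclic (wires (formula_circuit p))"
    using wf_acyclic wf_measure wf_subset by blast
  moreover have "wires (formula_circuit p) \<subseteq> nodes (formula_circuit p) \<times> nodes (formula_circuit p)"
    using nodes_eq by (auto elim!: wires_formula_circuit)
  moreover have "root (formula_circuit p) \<notin> Domain (wires (formula_circuit p))"
  proof
    assume "root (formula_circuit p) \<in> Domain (wires (formula_circuit p))"
    then obtain v where "(to_nat p, v) \<in> wires (formula_circuit p)"
      by (auto simp: formula_circuit_def)
    then show False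
      by (rule wires_formula_circuit) (use size_subformula in force)
  qed
  moreover have "i < n" if "q \<in> subformulas p" "formula_gate q = Input i" for q i
    using that vars by (cases q) auto
  moreover have "formula_gate p \<noteq> Input i" for i
    using nonvar by (cases p) auto
  ultimately show ?thesis
    by (auto simp: is_circuit_def formula_circuit_def finite_subformulas self_subformula
        input_gates_def)
qed

text \<open>Shannon expansion: the formula for \<open>k + 1\<close> variables selects by
  \<open>FVar k\<close> between those of the two cofactors. \<open>restrict\<close> freezes the
  remaining coordinates at \<open>undefined\<close>.\<close>

lemma formula_complete:
  assumes "k \<le> n" "n \<ge> 1"
  shows "\<exists>p. (\<forall>i. FVar i \<in> subformulas p \<longrightarrow> i < n) \<and> (\<forall>i. p \<noteq> FVar i) \<and>
             (\<forall>a. eval_formula p a = f (restrict a {..<k}))"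
  using assms(1)
proof (induction k arbitrary: f)
  case 0
  \<comment> \<open>The basis has no constants, so they are built from variable 0, which exists
    because \<open>n \<ge> 1\<close>.\<close>
  define p where
    "p = (if f (\<lambda>_. undefined) then FOr (FVar 0) (FNot (FVar 0)) else FAnd (FVar 0) (FNot (FVar 0)))"
  show ?case
    using assms(2) by (intro exI[of _ p]) (auto simp: p_def)
next
  case (Suc k)
  obtain p where p: "\<forall>i. FVar i \<in> subformulas p \<longrightarrow> i < n"
      "\<And>a. eval_formula p a = f ((restrict a {..<k})(k := True))"
    using Suc.IH[of "\<lambda>a. f (a(k := True))"] Suc.prems by (auto simp del: restrict_apply fun_upd_restrict)
  obtain q where q: "\<forall>i. FVar i \<in> subformulas q \<longrightarrow> i < n"
      "\<And>a. eval_formula q a = f ((restrict a {..<k})(k := False))"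
    using Suc.IH[of "\<lambda>a. f (a(k := False))"] Suc.prems by (auto simp del: restrict_apply fun_upd_restrict)
  have "restrict a {..<Suc k} = (restrict a {..<k})(k := a k)" for a :: "nat \<Rightarrow> bool"
    by (auto simp: fun_eq_iff less_Suc_eq)
  then have "eval_formula (FOr (FAnd (FVar k) p) (FAnd (FNot (FVar k)) q)) a
      = f (restrict a {..<Suc k})" for a
    by (cases "a k") (simp_all only: p(2) q(2) eval_formula.simps simp_thms)
  moreover have "\<forall>i. FVar i \<in> subformulas (FOr (FAnd (FVar k) p) (FAnd (FNot (FVar k)) q)) \<longrightarrow> i < n"
    using p(1) q(1) Suc.prems by auto
  ultimately show ?case by (metis formula.distinct(3))
qed

text \<open>Makes the set of circuits in the definition of \<open>EC\<close> nonempty, so that its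
  infimum is attained.\<close>

lemma circuit_exists:
  assumes "n \<ge> 1"
  shows "\<exists>C. is_circuit n C \<and> computes n C f"
proof -
  obtain p where p: "\<forall>i. FVar i \<in> subformulas p \<longrightarrow> i < n" "\<forall>i. p \<noteq> FVar i"
      "\<And>a. eval_formula p a = f (restrict a {..<n})"
    using formula_complete[of n n f] assms by auto
  have "eval_formula p a = f a" if "a \<in> cube n" for a
    using that unfolding p(3) cube_def by (simp only: PiE_restrict)
  then have "outputs (formula_circuit p) a (root (formula_circuit p)) (f a)" if "a \<in> cube n" for a
    using outputs_formula_circuit[of p a p] that by (simp add: formula_circuit_def)
  then have "computes n (formula_circuit p) f"
    by (simp add: computes_def)
  moreover have "is_circuit n (formula_circuit p)"
    using p by (intro is_circuit_formula_circuit) auto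
  ultimately show ?thesis by blast
qed

section \<open>Values of nodes\<close>

text \<open>True input gates are included although the energy does not count them, since
  certificates have to reach the variables.\<close>

definition true_nodes :: "circuit \<Rightarrow> (nat \<Rightarrow> bool) \<Rightarrow> nat set" where
  "true_nodes C a = {v \<in> nodes C. outputs C a v True}"

lemma outputs_unique: "outputs C a v p \<Longrightarrow> outputs C a v q \<Longrightarrow> p = q"
proof (induction arbitrary: q rule: outputs.induct)
  case (Input v i)
  from Input(2,1) show ?case by cases auto
next
  case (And v u w p p')
  from And.prems And.hyps show ?case by cases (auto dest: And.IH)
next
  case (Or v u w p p')
  from Or.prems Or.hyps show ?case by cases (auto dest: Or.IH)
next
  case (Not v u p)
  from Not.prems Not.hyps show ?case by cases (auto dest: Not.IH)
qed

lemma finite_args: "finite (args g)"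
  by (cases g) auto

lemma card_args_le: "card (args g) \<le> 2"
  by (cases g) (auto simp: card_insert_if)

lemma wf_wires:
  assumes "is_circuit n C"
  shows "wf (wires C)"
proof -
  have "finite (wires C)"
    using assms finite_subset[of "wires C" "nodes C \<times> nodes C"] by (auto simp: is_circuit_def)
  then show ?thesis
    using assms finite_acyclic_wf by (auto simp: is_circuit_def)
qed

lemma args_in_nodes: "is_circuit n C \<Longrightarrow> v \<in> nodes C \<Longrightarrow> args (label C v) \<subseteq> nodes C"
  by (auto simp: is_circuit_def wires_def)

lemma outputs_exists:
  assumes "is_circuit n C" "v \<in> nodes C"
  shows "\<exists>b. outputs C a v b"
  using wf_wires[OF assms(1)] assms(2)
proof (induction v rule: wf_induct_rule)
  case (less v)
  have IH: "\<exists>b. outputs C a u b" if "u \<in> args (label C v)" for u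
    using that less args_in_nodes[OF assms(1)] by (auto simp: wires_def)
  show ?case
  proof (cases "label C v")
    case (Input i)
    then show ?thesis by (blast intro: outputs.Input)
  next
    case (And u w)
    then show ?thesis using IH[of u] IH[of w] by (auto intro: outputs.And)
  next
    case (Or u w)
    then show ?thesis using IH[of u] IH[of w] by (auto intro: outputs.Or)
  next
    case (Not u)
    then show ?thesis using IH[of u] by (auto intro: outputs.Not)
  qed
qed

lemma outputs_iff:
  assumes "is_circuit n C" "v \<in> nodes C"
  shows "outputs C a v b \<longleftrightarrow> b = (v \<in> true_nodes C a)"
proof -
  obtain c where c: "outputs C a v c"
    using outputs_exists[OF assms] by blast
  have "outputs C a v d \<longleftrightarrow> d = c" for d
  proof
    show "d = c" if "outputs C a v d"
      using that c by (rule outputs_unique)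
    show "outputs C a v d" if "d = c"
      using c that by (simp only:)
  qed
  then show ?thesis
    using assms(2) by (auto simp: true_nodes_def)
qed

lemma true_nodes_Input:
  "v \<in> nodes C \<Longrightarrow> label C v = Input i \<Longrightarrow> v \<in> true_nodes C a \<longleftrightarrow> a i"
  using outputs.Input[of C v i a] outputs_unique[of C a v "a i" True]
  by (auto simp: true_nodes_def)

lemma true_nodes_And:
  assumes "is_circuit n C" "v \<in> nodes C" "label C v = And u w"
  shows "v \<in> true_nodes C a \<longleftrightarrow> u \<in> true_nodes C a \<and> w \<in> true_nodes C a"
proof -
  have "u \<in> nodes C" "w \<in> nodes C"
    using args_in_nodes[OF assms(1,2)] assms(3) by auto
  then show ?thesis
    using outputs.And[OF assms(3), of a "u \<in> true_nodes C a" "w \<in> true_nodes C a"] assms(2)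
    by (simp add: outputs_iff[OF assms(1)])
qed

lemma true_nodes_Or:
  assumes "is_circuit n C" "v \<in> nodes C" "label C v = Or u w"
  shows "v \<in> true_nodes C a \<longleftrightarrow> u \<in> true_nodes C a \<or> w \<in> true_nodes C a"
proof -
  have "u \<in> nodes C" "w \<in> nodes C"
    using args_in_nodes[OF assms(1,2)] assms(3) by auto
  then show ?thesis
    using outputs.Or[OF assms(3), of a "u \<in> true_nodes C a" "w \<in> true_nodes C a"] assms(2)
    by (simp add: outputs_iff[OF assms(1)])
qed

lemma true_nodes_Not:
  assumes "is_circuit n C" "v \<in> nodes C" "label C v = Not u"
  shows "v \<in> true_nodes C a \<longleftrightarrow> u \<notin> true_nodes C a"
proof -
  have "u \<in> nodes C"
    using args_in_nodes[OF assms(1,2)] assms(3) by auto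
  then show ?thesis
    using outputs.Not[OF assms(3), of a "u \<in> true_nodes C a"] assms(2)
    by (simp add: outputs_iff[OF assms(1)])
qed

section \<open>Energy bounds on true gates and negated nodes\<close>

lemma finite_cube: "finite (cube n)"
  by (simp add: cube_def finite_PiE)

lemma card_true_gates_le:
  assumes "a \<in> cube n"
  shows "card (true_nodes C a \<inter> (nodes C - input_gates C)) \<le> EC_circuit n C"
proof -
  have "true_nodes C a \<inter> (nodes C - input_gates C) = {v \<in> nodes C - input_gates C. outputs C a v True}"
    by (auto simp: true_nodes_def)
  with assms show ?thesis
    unfolding EC_circuit_def by (intro Max_ge) (auto simp: finite_cube EC_at_def)
qed

definition negated_nodes :: "circuit \<Rightarrow> nat set" where
  "negated_nodes C = {u. \<exists>v \<in> nodes C. label C v = Not u}"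

lemma card_negated_nodes_le:
  assumes C: "is_circuit n C"
  shows "finite (negated_nodes C)" "card (negated_nodes C) \<le> 2 * EC_circuit n C"
proof -
  define a :: "nat \<Rightarrow> bool" where "a = restrict (\<lambda>_. False) {..<n}"
  define F where "F = true_nodes C a \<inter> (nodes C - input_gates C)"
  have a: "a \<in> cube n"
    by (auto simp: a_def cube_def)
  have "finite (nodes C)"
    using C by (simp add: is_circuit_def)
  then have finF: "finite F"
    by (simp add: F_def)
  \<comment> \<open>One NOT gate is chosen above each negated node; the choice is injective because
    a NOT gate has a single argument.\<close>
  define m where "m u = (SOME v. v \<in> nodes C \<and> label C v = Not u)" for u
  have m: "m u \<in> nodes C \<and> label C (m u) = Not u" if "u \<in> negated_nodes C" for u
    unfolding m_def by (rule someI_ex) (use that in \<open>auto simp: negated_nodes_def\<close>)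
  define A where "A = {u \<in> negated_nodes C. m u \<in> F}"
  have inj: "inj_on m A"
    by (rule inj_onI) (metis (no_types, lifting) A_def m gate.inject(4) mem_Collect_eq)
  have "m ` A \<subseteq> F"
    by (auto simp: A_def)
  with inj finF have A: "finite A" "card A \<le> card F"
    by (auto intro: inj_on_finite card_inj_on_le)
  \<comment> \<open>All variables are 0 on \<open>a\<close>, so a true negated node is a non-input
    gate and lies in \<open>F\<close>; for a false one the NOT gate \<open>m u\<close>
    fires.\<close>
  have "negated_nodes C \<subseteq> F \<union> A"
  proof
    fix u assume u: "u \<in> negated_nodes C"
    have un: "u \<in> nodes C"
      using m[OF u] args_in_nodes[OF C, of "m u"] by simp
    show "u \<in> F \<union> A"
    proof (cases "u \<in> true_nodes C a")
      case True
      have "label C u \<noteq> Input i" for i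
      proof
        assume i: "label C u = Input i"
        then have "i < n"
          using C un by (auto simp: is_circuit_def)
        then show False
          using True true_nodes_Input[OF un i, of a] by (simp add: a_def)
      qed
      with True un show ?thesis
        by (auto simp: F_def input_gates_def)
    next
      case False
      with m[OF u] u true_nodes_Not[OF C, of "m u" u a] show ?thesis
        by (auto simp: A_def F_def input_gates_def)
    qed
  qed
  moreover have "finite (F \<union> A)"
    using A(1) finF by simp
  ultimately have "card (negated_nodes C) \<le> card (F \<union> A)" and fin: "finite (negated_nodes C)"
    by (auto intro: card_mono finite_subset)
  then have "card (negated_nodes C) \<le> card F + card A"
    using card_Un_le[of F A] by linarith
  with A(2) card_true_gates_le[OF a, of C] show "card (negated_nodes C) \<le> 2 * EC_circuit n C"
    unfolding F_def by linarith
  show "finite (negated_nodes C)" by (rule fin)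
qed

section \<open>Transfer of certificates\<close>

text \<open>Only true arguments are followed: they justify AND and OR gates, while a true NOT gate
  rests on a false node outside \<open>K\<close>.\<close>

definition certificate :: "circuit \<Rightarrow> nat set \<Rightarrow> (nat \<Rightarrow> bool) \<Rightarrow> bool" where
  "certificate C K a \<longleftrightarrow>
     K \<subseteq> true_nodes C a \<and> (\<forall>v \<in> K. args (label C v) \<inter> true_nodes C a \<subseteq> K)"

text \<open>Induction along the wires. AND and OR are monotone, so it suffices that their true
  arguments stay true; a true NOT gate needs its argument to stay false, which is
  \<open>neg\<close>. As \<open>neg\<close> concerns only nodes strictly below \<open>j\<close>, it
  leaves the value of \<open>j\<close> itself open.\<close>

lemma certificate_transfer:
  assumes C: "is_circuit n C" and K: "certificate C K a" and "j \<in> K"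
    and inp: "\<And>v i. v \<in> K \<Longrightarrow> label C v = Input i \<Longrightarrow> b i"
    and neg: "\<And>u. u \<in> negated_nodes C \<Longrightarrow> (u, j) \<in> (wires C)\<^sup>+ \<Longrightarrow>
                u \<notin> true_nodes C a \<Longrightarrow> u \<notin> true_nodes C b"
  shows "j \<in> true_nodes C b"
  using wf_wires[OF C] \<open>j \<in> K\<close> neg
proof (induction j rule: wf_induct_rule)
  case (less j)
  have j: "j \<in> nodes C" "j \<in> true_nodes C a"
    using K less.prems(1) by (auto simp: certificate_def true_nodes_def)
  have IH: "u \<in> true_nodes C b" if "u \<in> args (label C j)" "u \<in> true_nodes C a" for u
  proof -
    have w: "(u, j) \<in> wires C"
      using that j by (auto simp: wires_def)
    show ?thesis
    proof (rule less.IH[OF w])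
      show "u \<in> K"
        using K that less.prems(1) by (auto simp: certificate_def)
      show "u' \<notin> true_nodes C b"
        if "u' \<in> negated_nodes C" "(u', u) \<in> (wires C)\<^sup>+" "u' \<notin> true_nodes C a" for u'
        using less.prems(2) that w trancl_into_trancl by metis
    qed
  qed
  show ?case
  proof (cases "label C j")
    case (Input i)
    then show ?thesis
      using inp less.prems(1) j true_nodes_Input by blast
  next
    case (And u w)
    then show ?thesis
      using IH j true_nodes_And[OF C j(1) And] by simp
  next
    case (Or u w)
    then show ?thesis
      using IH j true_nodes_Or[OF C j(1) Or] by auto
  next
    case (Not u)
    then have "u \<in> negated_nodes C" "(u, j) \<in> (wires C)\<^sup>+"
      using j by (auto simp: negated_nodes_def wires_def)
    then show ?thesis
      using less.prems(2) j true_nodes_Not[OF C j(1) Not] by simp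
  qed
qed

section \<open>Protocols on rectangles\<close>

definition solvable :: "nat \<Rightarrow> (nat \<Rightarrow> bool) set \<Rightarrow> (nat \<Rightarrow> bool) set \<Rightarrow> nat \<Rightarrow> bool" where
  "solvable n X Y c \<longleftrightarrow>
     (\<exists>P. cost P \<le> c \<and> (\<forall>x \<in> X. \<forall>y \<in> Y. run P x y < n \<and> x (run P x y) \<and> \<not> y (run P x y)))"

lemma solvable_mono: "solvable n X Y c \<Longrightarrow> c \<le> d \<Longrightarrow> solvable n X Y d"
  unfolding solvable_def by (meson order_trans)

lemma solvable_empty: "solvable n {} Y c" "solvable n X {} c"
  unfolding solvable_def by (rule exI[of _ "Answer 0"], simp)+

lemma solvable_Alice:
  assumes "solvable n {x \<in> X. b x} Y c" "solvable n {x \<in> X. \<not> b x} Y c"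
  shows "solvable n X Y (Suc c)"
proof -
  from assms obtain P Q where "cost P \<le> c" "cost Q \<le> c"
    "\<forall>x \<in> {x \<in> X. b x}. \<forall>y \<in> Y. run P x y < n \<and> x (run P x y) \<and> \<not> y (run P x y)"
    "\<forall>x \<in> {x \<in> X. \<not> b x}. \<forall>y \<in> Y. run Q x y < n \<and> x (run Q x y) \<and> \<not> y (run Q x y)"
    unfolding solvable_def by blast
  then show ?thesis
    unfolding solvable_def by (intro exI[of _ "Alice b P Q"]) auto
qed

lemma solvable_Bob:
  assumes "solvable n X {y \<in> Y. b y} c" "solvable n X {y \<in> Y. \<not> b y} c"
  shows "solvable n X Y (Suc c)"
proof -
  from assms obtain P Q where "cost P \<le> c" "cost Q \<le> c"
    "\<forall>x \<in> X. \<forall>y \<in> {y \<in> Y. b y}. run P x y < n \<and> x (run P x y) \<and> \<not> y (run P x y)"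
    "\<forall>x \<in> X. \<forall>y \<in> {y \<in> Y. \<not> b y}. run Q x y < n \<and> x (run Q x y) \<and> \<not> y (run Q x y)"
    unfolding solvable_def by blast
  then show ?thesis
    unfolding solvable_def by (intro exI[of _ "Bob b P Q"]) auto
qed

text \<open>Bob goes through the candidates and spends one bit on each to say whether it is right.
  Not knowing \<open>x\<close>, he needs an index that serves all of \<open>X\<close>.\<close>

lemma solvable_select:
  assumes "finite I" "\<And>y. y \<in> Y \<Longrightarrow> \<exists>i \<in> I. \<forall>x \<in> X. i < n \<and> x i \<and> \<not> y i"
  shows "solvable n X Y (card I)"
  using assms
proof (induction I arbitrary: Y rule: finite_induct)
  case empty
  then have "Y = {}" by auto
  then show ?case by (simp add: solvable_empty)
next
  case (insert i I)
  let ?b = "\<lambda>y. \<forall>x \<in> X. i < n \<and> x i \<and> \<not> y i"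
  have "solvable n X {y \<in> Y. ?b y} (card I)"
    unfolding solvable_def by (rule exI[of _ "Answer i"]) auto
  moreover have "solvable n X {y \<in> Y. \<not> ?b y} (card I)"
    using insert.prems by (intro insert.IH) blast
  ultimately show ?case
    using insert.hyps solvable_Bob[of n X Y ?b] by simp
qed

section \<open>Announcing the true nodes below a queue\<close>

text \<open>\<open>\<Phi> X c\<close> is solvability at cost \<open>c\<close> as a function of the set \<open>X\<close> of inputs of one of the two
  players, who may split \<open>X\<close> by sending a bit.\<close>

definition speaks :: "('a set \<Rightarrow> nat \<Rightarrow> bool) \<Rightarrow> bool" where
  "speaks \<Phi> \<longleftrightarrow>
     (\<forall>X b c. \<Phi> {x \<in> X. b x} c \<longrightarrow> \<Phi> {x \<in> X. \<not> b x} c \<longrightarrow> \<Phi> X (Suc c)) \<and>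
     (\<forall>X c d. \<Phi> X c \<longrightarrow> c \<le> d \<longrightarrow> \<Phi> X d) \<and> (\<forall>c. \<Phi> {} c)"

lemma speaks_split:
  "speaks \<Phi> \<Longrightarrow> \<Phi> {x \<in> X. b x} c \<Longrightarrow> \<Phi> {x \<in> X. \<not> b x} c \<Longrightarrow> \<Phi> X (Suc c)"
  and speaks_mono: "speaks \<Phi> \<Longrightarrow> \<Phi> X c \<Longrightarrow> c \<le> d \<Longrightarrow> \<Phi> X d"
  and speaks_empty: "speaks \<Phi> \<Longrightarrow> \<Phi> {} c"
  by (simp_all add: speaks_def)

lemma speaks_Alice: "speaks (\<lambda>X. solvable n X Y)"
  unfolding speaks_def using solvable_Alice solvable_mono solvable_empty(1) by blast

lemma speaks_Bob: "speaks (solvable n X)"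
  unfolding speaks_def using solvable_Bob solvable_mono solvable_empty(2) by blast

text \<open>Invariant of the search: \<open>K\<close> holds the true nodes already expanded and
  \<open>Q\<close> those still to be asked about. With empty \<open>Q\<close> it is the closure
  property of a certificate.\<close>

definition pending :: "('v \<Rightarrow> 'v set) \<Rightarrow> 'v set \<Rightarrow> 'v set \<Rightarrow> 'v set \<Rightarrow> bool" where
  "pending A T K Q \<longleftrightarrow> K \<subseteq> T \<and> (\<forall>v \<in> K. A v \<inter> T \<subseteq> K \<union> Q)"

text \<open>One player announces, bit by bit, which nodes of the queue \<open>Q\<close> are true; the arguments of every
  true gate join the queue. A true gate pays for itself and for its two arguments, whence the
  factor 3.\<close>

lemma explore:
  fixes \<Phi> :: "'a set \<Rightarrow> nat \<Rightarrow> bool" and T :: "'a \<Rightarrow> 'v set"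
  assumes \<Phi>: "speaks \<Phi>"
    and A: "\<And>v. finite (A v)" "\<And>v. card (A v) \<le> 2" "\<And>v. v \<notin> W \<Longrightarrow> A v = {}"
    and "finite K" "finite Q"
    and "\<forall>x \<in> X. finite (T x) \<and> card (T x \<inter> W) \<le> s \<and> pending A (T x) K Q"
    and "\<And>X' K'. X' \<subseteq> X \<Longrightarrow> finite K' \<Longrightarrow> card K' \<le> card K + card Q + 3 * (s - card (K \<inter> W)) \<Longrightarrow>
           K \<subseteq> K' \<Longrightarrow> \<forall>x \<in> X'. Q \<inter> T x \<subseteq> K' \<and> pending A (T x) K' {} \<Longrightarrow> \<Phi> X' c"
  shows "\<Phi> X (card Q + 3 * (s - card (K \<inter> W)) + c)"
  using assms(5-)
proof (induction "card Q + 3 * (s - card (K \<inter> W))" arbitrary: X K Q rule: less_induct)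
  case less
  note finK = less.prems(1) and finQ = less.prems(2) and X = less.prems(3) and result = less.prems(4)
  show ?case
  proof (cases "Q = {}")
    case True
    have "\<Phi> X c"
    proof (rule result)
      show "\<forall>x \<in> X. Q \<inter> T x \<subseteq> K \<and> pending A (T x) K {}"
        using X True by simp
    qed (simp_all add: finK)
    then show ?thesis by (rule speaks_mono[OF \<Phi>]) simp
  next
    case False
    then obtain v where v: "v \<in> Q" by auto
    then have cQ: "card Q = Suc (card (Q - {v}))"
      using finQ by (metis card_Suc_Diff1)
    define M where "M = card (Q - {v}) + 3 * (s - card (K \<inter> W))"
    \<comment> \<open>Covers two ways to drop \<open>v\<close>: it is already in \<open>K\<close>,
      at no cost, or it has just been announced false.\<close>
    have skip: "\<Phi> X0 (M + c)" if "X0 \<subseteq> X" "\<And>x. x \<in> X0 \<Longrightarrow> v \<in> K \<or> v \<notin> T x" for X0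
      unfolding M_def
    proof (rule less.hyps)
      show "card (Q - {v}) + 3 * (s - card (K \<inter> W)) < card Q + 3 * (s - card (K \<inter> W))"
        using cQ by simp
      show "\<forall>x \<in> X0. finite (T x) \<and> card (T x \<inter> W) \<le> s \<and> pending A (T x) K (Q - {v})"
      proof
        fix x assume x: "x \<in> X0"
        with X that(1) have "finite (T x) \<and> card (T x \<inter> W) \<le> s \<and> pending A (T x) K Q" by blast
        with that(2)[OF x] show "finite (T x) \<and> card (T x \<inter> W) \<le> s \<and> pending A (T x) K (Q - {v})"
          unfolding pending_def by blast
      qed
      fix X' K'
      assume *: "X' \<subseteq> X0" "finite K'" "card K' \<le> card K + card (Q - {v}) + 3 * (s - card (K \<inter> W))"
        "K \<subseteq> K'" "\<forall>x \<in> X'. (Q - {v}) \<inter> T x \<subseteq> K' \<and> pending A (T x) K' {}"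
      show "\<Phi> X' c"
      proof (rule result)
        show "X' \<subseteq> X" using *(1) that(1) by blast
        show "card K' \<le> card K + card Q + 3 * (s - card (K \<inter> W))"
          using *(3) cQ by linarith
        show "\<forall>x \<in> X'. Q \<inter> T x \<subseteq> K' \<and> pending A (T x) K' {}"
          using *(1,4,5) that(2) by blast
      qed (fact *)+
    qed (use finK finQ in simp_all)
    show ?thesis
    proof (cases "v \<in> K")
      case True
      then have "\<Phi> X (M + c)" by (intro skip) auto
      then show ?thesis by (rule speaks_mono[OF \<Phi>]) (simp add: cQ M_def)
    next
      case False
      have "\<Phi> {x \<in> X. v \<notin> T x} (M + c)"
        by (rule skip) auto
      moreover have "\<Phi> {x \<in> X. v \<in> T x} (M + c)"
      \<comment> \<open>Subtraction on \<open>nat\<close> truncates: only an actual input with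
        \<open>v\<close> true shows that \<open>K\<close> with \<open>v\<close> added still has at
        most \<open>s\<close> nodes in \<open>W\<close>, so that the term
        \<open>3 * (s - ...)\<close> really drops by 3 for a gate.\<close>
      proof (cases "{x \<in> X. v \<in> T x} = {}")
        case True
        then show ?thesis using speaks_empty[OF \<Phi>] by metis
      next
        case nonempty: False
        let ?K = "insert v K" and ?Q = "(Q - {v}) \<union> A v"
        obtain x where x: "x \<in> X" "v \<in> T x" using nonempty by auto
        then have "finite (T x \<inter> W)" "?K \<inter> W \<subseteq> T x \<inter> W" "card (T x \<inter> W) \<le> s"
          using X by (auto simp: pending_def)
        then have cK: "card (?K \<inter> W) \<le> s"
          by (meson card_mono order_trans)
        have Q': "card ?Q \<le> card (Q - {v}) + card (A v)" by (rule card_Un_le)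
        have K': "card ?K = Suc (card K)" using False finK by simp
        \<comment> \<open>A gate of \<open>W\<close> releases 3 units, for its entry in
          \<open>K\<close> and at most two new queue entries. A node outside \<open>W\<close> adds
          nothing to the queue, and its own place there pays for its entry in
          \<open>K\<close>.\<close>
        have "card (?K \<inter> W) = Suc (card (K \<inter> W)) \<and> card (A v) \<le> 2 \<or>
              card (?K \<inter> W) = card (K \<inter> W) \<and> card (A v) = 0"
          using False finK A(2,3)[of v] by (cases "v \<in> W") auto
        then have bound: "card ?Q + 3 * (s - card (?K \<inter> W)) \<le> M"
          "card ?K + card ?Q + 3 * (s - card (?K \<inter> W)) \<le> card K + card Q + 3 * (s - card (K \<inter> W))"
          using Q' K' cK cQ unfolding M_def by arith+
        have "\<Phi> {x \<in> X. v \<in> T x} (card ?Q + 3 * (s - card (?K \<inter> W)) + c)"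
        proof (rule less.hyps)
          show "card ?Q + 3 * (s - card (?K \<inter> W)) < card Q + 3 * (s - card (K \<inter> W))"
            using bound(1) cQ unfolding M_def by linarith
          show "\<forall>x \<in> {x \<in> X. v \<in> T x}. finite (T x) \<and> card (T x \<inter> W) \<le> s \<and> pending A (T x) ?K ?Q"
          proof
            fix x assume "x \<in> {x \<in> X. v \<in> T x}"
            with X have "v \<in> T x" "finite (T x) \<and> card (T x \<inter> W) \<le> s \<and> pending A (T x) K Q"
              by blast+
            then show "finite (T x) \<and> card (T x \<inter> W) \<le> s \<and> pending A (T x) ?K ?Q"
              unfolding pending_def by blast
          qed
          fix X' K'
          assume *: "X' \<subseteq> {x \<in> X. v \<in> T x}" "finite K'"
            "card K' \<le> card ?K + card ?Q + 3 * (s - card (?K \<inter> W))"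
            "?K \<subseteq> K'" "\<forall>x \<in> X'. ?Q \<inter> T x \<subseteq> K' \<and> pending A (T x) K' {}"
          show "\<Phi> X' c"
          proof (rule result)
            show "X' \<subseteq> X" "K \<subseteq> K'" using *(1,4) by blast+
            show "card K' \<le> card K + card Q + 3 * (s - card (K \<inter> W))"
              using *(3) bound(2) by linarith
            show "\<forall>x \<in> X'. Q \<inter> T x \<subseteq> K' \<and> pending A (T x) K' {}"
              using *(4,5) by blast
          qed (fact *)
        qed (use finK finQ A(1) in simp_all)
        then show ?thesis by (rule speaks_mono[OF \<Phi>]) (use bound(1) in linarith)
      qed
      ultimately have "\<Phi> X (Suc (M + c))"
        by (intro speaks_split[OF \<Phi>, of X "\<lambda>x. v \<in> T x"])
      then show ?thesis by (rule speaks_mono[OF \<Phi>]) (simp add: cQ M_def)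
    qed
  qed
qed

section \<open>The protocol of a circuit\<close>

text \<open>The search started with nothing expanded and queue \<open>R\<close>. The map
  \<open>g\<close> turns a player's input into the one fed to the circuit: the identity for Bob,
  \<open>join_vars I\<close> for Alice.\<close>

lemma explore_circuit:
  assumes \<Phi>: "speaks \<Phi>"
    and C: "is_circuit n C"
    and "finite R" and g: "\<And>x. x \<in> X \<Longrightarrow> g x \<in> cube n"
    and result: "\<And>X' K. X' \<subseteq> X \<Longrightarrow> finite K \<Longrightarrow> card K \<le> card R + 3 * EC_circuit n C \<Longrightarrow>
           (\<And>x. x \<in> X' \<Longrightarrow> certificate C K (g x)) \<Longrightarrow>
           (\<And>x. x \<in> X' \<Longrightarrow> R \<inter> true_nodes C (g x) \<subseteq> K) \<Longrightarrow> \<Phi> X' c"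
  shows "\<Phi> X (card R + 3 * EC_circuit n C + c)"
proof -
  \<comment> \<open>Labels outside \<open>nodes C\<close> are arbitrary; cutting them off leaves
    arguments only to the gates in \<open>W\<close>.\<close>
  define A where "A v = (if v \<in> nodes C then args (label C v) else {})" for v
  define W where "W = nodes C - input_gates C"
  have A: "finite (A v)" "card (A v) \<le> 2" "v \<notin> W \<Longrightarrow> A v = {}" for v
    using finite_args card_args_le by (auto simp: A_def W_def input_gates_def)
  have fin: "finite (true_nodes C a)" for a
    using C by (auto simp: is_circuit_def true_nodes_def)
  have "\<Phi> X (card R + 3 * (EC_circuit n C - card ({} \<inter> W)) + c)"
  proof (rule explore[where T = "\<lambda>x. true_nodes C (g x)" and A = A])
    show "\<forall>x \<in> X. finite (true_nodes C (g x)) \<and> card (true_nodes C (g x) \<inter> W) \<le> EC_circuit n C \<and>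
        pending A (true_nodes C (g x)) {} R"
      by (simp add: W_def pending_def fin card_true_gates_le g)
    fix X' K
    assume X': "X' \<subseteq> X" and "finite K"
      and card: "card K \<le> card {} + card R + 3 * (EC_circuit n C - card ({} \<inter> W))"
      and K: "\<forall>x \<in> X'. R \<inter> true_nodes C (g x) \<subseteq> K \<and> pending A (true_nodes C (g x)) K {}"
    from X' \<open>finite K\<close> show "\<Phi> X' c"
    proof (rule result)
      show "card K \<le> card R + 3 * EC_circuit n C"
        using card by simp
      show "R \<inter> true_nodes C (g x) \<subseteq> K" if "x \<in> X'" for x
        using K that by blast
      show "certificate C K (g x)" if "x \<in> X'" for x
      proof -
        have "K \<subseteq> true_nodes C (g x)" "K \<subseteq> nodes C" "\<forall>v \<in> K. A v \<inter> true_nodes C (g x) \<subseteq> K"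
          using K that by (auto simp: pending_def true_nodes_def)
        moreover from this have "A v = args (label C v)" if "v \<in> K" for v
          unfolding A_def using that by (simp only: subsetD if_True)
        ultimately show ?thesis
          unfolding certificate_def by (metis (no_types))
      qed
    qed
  qed (rule \<Phi> A finite.emptyI \<open>finite R\<close> | assumption)+
  then show ?thesis by simp
qed

definition join_vars :: "nat set \<Rightarrow> (nat \<Rightarrow> bool) \<Rightarrow> nat \<Rightarrow> bool" where
  "join_vars I x = (\<lambda>i. x i \<or> i \<in> I)"

text \<open>The first node of \<open>R\<close>, in topological order, on which the two certificates disagree must be
  true for Alice and false for Bob; hence Bob's input violates some variable of Alice's
  certificate.\<close>

lemma certificates_separate:
  assumes C: "is_circuit n C" and K: "certificate C K y" and L: "certificate C L z"
    and R: "negated_nodes C \<subseteq> R" "R \<inter> true_nodes C y \<subseteq> K" "R \<inter> true_nodes C z \<subseteq> L"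
    and inp: "\<And>v i. v \<in> K \<Longrightarrow> label C v = Input i \<Longrightarrow> z i"
    and r: "r \<in> R" "r \<in> true_nodes C z" "r \<notin> true_nodes C y"
  shows "\<exists>v \<in> L. \<exists>i. label C v = Input i \<and> \<not> y i"
proof (rule ccontr)
  assume "\<not> ?thesis"
  then have inpL: "\<And>v i. v \<in> L \<Longrightarrow> label C v = Input i \<Longrightarrow> y i" by auto
  define D where "D = {u \<in> R. (u \<in> true_nodes C z) \<noteq> (u \<in> true_nodes C y)}"
  have "r \<in> D" using r by (simp add: D_def)
  \<comment> \<open>Minimality is taken along paths, not single wires, since a lower node of
    \<open>D\<close> may be reachable only through nodes outside \<open>R\<close>.\<close>
  then obtain j where j: "j \<in> D" "\<And>u. (u, j) \<in> (wires C)\<^sup>+ \<Longrightarrow> u \<notin> D"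
    using wfE_min[OF wf_trancl[OF wf_wires[OF C]]] by metis
  have agree: "u \<in> true_nodes C z \<longleftrightarrow> u \<in> true_nodes C y"
    if "u \<in> negated_nodes C" "(u, j) \<in> (wires C)\<^sup>+" for u
    using j(2)[OF that(2)] that(1) R(1) by (auto simp: D_def)
  \<comment> \<open>As a node of \<open>D\<close>, \<open>j\<close> is true on exactly one of
    \<open>y\<close> and \<open>z\<close>, hence lies in \<open>K\<close> or in \<open>L\<close>;
    transfer makes it true on the other as well.\<close>
  have "j \<in> true_nodes C z" if "j \<in> K"
    by (rule certificate_transfer[OF C K that]) (simp_all add: inp agree)
  moreover have "j \<in> true_nodes C y" if "j \<in> L"
    by (rule certificate_transfer[OF C L that]) (simp_all add: inpL agree)
  ultimately show False
    using j(1) R by (auto simp: D_def)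
qed

text \<open>Three phases of at most \<open>q\<close> bits each: Bob explores, Alice explores, Bob
  names a variable of her certificate. Since \<open>q \<le> 5 * s + 1\<close>, the total is at most
  \<open>15 * s + 3\<close>, which is at most \<open>18 * s\<close> once
  \<open>s \<ge> 1\<close>.\<close>

lemma KW_mono_le_EC_circuit:
  assumes f: "mono_on (cube n) f" and C: "is_circuit n C" "computes n C f"
  shows "KW_mono n f \<le> 18 * EC_circuit n C"
proof -
  define s where "s = EC_circuit n C"
  \<comment> \<open>The root ensures that \<open>R\<close> contains a node true for Alice and false
    for Bob.\<close>
  define R where "R = insert (root C) (negated_nodes C)"
  define X where "X = {x \<in> cube n. f x}"
  define Y where "Y = {y \<in> cube n. \<not> f y}"
  define q where "q = card R + 3 * s"
  have finR: "finite R" and cardR: "card R \<le> 2 * s + 1"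
    using card_negated_nodes_le[OF C(1)] by (auto simp: R_def s_def card_insert_if)
  have root: "root C \<in> true_nodes C a \<longleftrightarrow> f a" if "a \<in> cube n" for a
    using C that outputs_iff[OF C(1), of "root C" a "f a"]
    by (auto simp: computes_def is_circuit_def)
  have "solvable n X Y (q + (q + q))"
    unfolding q_def s_def
  proof (rule explore_circuit[where \<Phi> = "solvable n X" and g = "\<lambda>y. y"])
    fix Y' K
    assume Y': "Y' \<subseteq> Y" and K: "\<And>y. y \<in> Y' \<Longrightarrow> certificate C K y"
      and RK: "\<And>y. y \<in> Y' \<Longrightarrow> R \<inter> true_nodes C y \<subseteq> K"
    define I where "I = {i. \<exists>v \<in> K. label C v = Input i}"
    show "solvable n X Y' (card R + 3 * EC_circuit n C + (card R + 3 * EC_circuit n C))"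
    proof (cases "Y' = {}")
      case True
      then show ?thesis by (simp add: solvable_empty)
    next
      case False
      have Kn: "K \<subseteq> nodes C"
        using False K by (auto simp: certificate_def true_nodes_def)
      \<comment> \<open>Indices below \<open>n\<close> keep \<open>join_vars I x\<close>
        extensional, hence in the cube.\<close>
      then have In: "I \<subseteq> {..<n}"
        using C(1) by (auto simp: I_def is_circuit_def)
      have Iy: "y i" if "y \<in> Y'" "i \<in> I" for y i
      proof -
        from \<open>i \<in> I\<close> obtain v where v: "v \<in> K" "label C v = Input i"
          by (auto simp: I_def)
        then have "v \<in> nodes C" "v \<in> true_nodes C y"
          using K[OF \<open>y \<in> Y'\<close>] Kn by (auto simp: certificate_def)
        then show ?thesis
          using true_nodes_Input v(2) by blast
      qed
      have join: "join_vars I x \<in> cube n \<and> f (join_vars I x)" if "x \<in> X" for x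
      proof -
        have x: "x \<in> cube n" "f x" using that by (auto simp: X_def)
        then have "join_vars I x \<in> cube n"
          using In by (auto simp: cube_def join_vars_def PiE_iff extensional_def)
        moreover have "x \<le> join_vars I x"
          by (auto simp: join_vars_def le_fun_def)
        ultimately show ?thesis
          using f x by (auto dest: mono_onD)
      qed
      show ?thesis
      proof (rule explore_circuit[where \<Phi> = "\<lambda>X. solvable n X Y'" and g = "join_vars I"])
        fix X' L
        assume X': "X' \<subseteq> X" and finL: "finite L" and cardL: "card L \<le> card R + 3 * EC_circuit n C"
          and L: "\<And>x. x \<in> X' \<Longrightarrow> certificate C L (join_vars I x)"
          and RL: "\<And>x. x \<in> X' \<Longrightarrow> R \<inter> true_nodes C (join_vars I x) \<subseteq> L"
        define h where "h v = (case label C v of Input i \<Rightarrow> i | _ \<Rightarrow> 0)" for v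
        show "solvable n X' Y' (card R + 3 * EC_circuit n C)"
        proof (cases "X' = {}")
          case True
          then show ?thesis by (simp add: solvable_empty)
        next
          case False
          \<comment> \<open>Any single \<open>x0\<close> yields the index: all inputs left to Alice
            share the certificate \<open>L\<close>, so its variables hold for each of them after
            joining \<open>I\<close>.\<close>
          then obtain x0 where x0: "x0 \<in> X'" by auto
          have "solvable n X' Y' (card (h ` L))"
          proof (rule solvable_select)
            fix y assume y: "y \<in> Y'"
            then have y_cube: "y \<in> cube n" "\<not> f y" using Y' by (auto simp: Y_def)
            have z: "join_vars I x0 \<in> cube n" "f (join_vars I x0)"
              using join x0 X' by auto
            have "\<exists>v \<in> L. \<exists>i. label C v = Input i \<and> \<not> y i"
            proof (rule certificates_separate[OF C(1) K[OF y] L[OF x0] _ RK[OF y] RL[OF x0]])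
              show "join_vars I x0 i" if "v \<in> K" "label C v = Input i" for v i
                using that by (auto simp: join_vars_def I_def)
            qed (use root z y_cube in \<open>auto simp: R_def\<close>)
            then obtain v i where v: "v \<in> L" "label C v = Input i" "\<not> y i" by blast
            have "v \<in> nodes C"
              using L[OF x0] v(1) by (auto simp: certificate_def true_nodes_def)
            with C(1) v(2) have "i < n" by (auto simp: is_circuit_def)
            moreover have "x i" if "x \<in> X'" for x
            proof -
              have "v \<in> true_nodes C (join_vars I x)"
                using L[OF that] v(1) by (auto simp: certificate_def)
              then have "join_vars I x i"
                using true_nodes_Input[OF \<open>v \<in> nodes C\<close> v(2)] by blast
              \<comment> \<open>\<open>Iy\<close> excludes \<open>i\<close> from \<open>I\<close>
                because \<open>y i\<close> is false, so \<open>i\<close> was 1 in \<open>x\<close>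
                before joining.\<close>
              then show ?thesis
                using Iy[OF y] v(3) by (auto simp: join_vars_def)
            qed
            moreover have "i \<in> h ` L"
              using v by (force simp: h_def)
            ultimately show "\<exists>i \<in> h ` L. \<forall>x \<in> X'. i < n \<and> x i \<and> \<not> y i"
              using v(3) by blast
          qed (use finL in auto)
          then show ?thesis
            by (rule solvable_mono) (use card_image_le[OF finL, of h] cardL in linarith)
        qed
      qed (use C(1) finR join speaks_Alice in simp_all)
    qed
  qed (use C(1) finR speaks_Bob in \<open>simp_all add: Y_def\<close>)
  then obtain P where P: "cost P \<le> q + (q + q)" "solves_KW_mono n f P"
    by (auto simp: solvable_def solves_KW_mono_def X_def Y_def Let_def)
  have KW: "KW_mono n f \<le> cost P" if "solves_KW_mono n f P" for P
    unfolding KW_mono_def using that by (auto intro: cINF_lower)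
  show ?thesis
  \<comment> \<open>The additive 3 cannot be absorbed when \<open>s = 0\<close>; but then the root
    never fires, \<open>f\<close> is constantly false and one leaf suffices.\<close>
  proof (cases "s = 0")
    case True
    have "\<not> f a" if a: "a \<in> cube n" for a
    proof
      assume "f a"
      then have "root C \<in> true_nodes C a \<inter> (nodes C - input_gates C)"
        using root[OF a] C(1) by (auto simp: is_circuit_def)
      moreover have "finite (true_nodes C a \<inter> (nodes C - input_gates C))"
        using C(1) by (simp add: is_circuit_def)
      ultimately show False
        using card_true_gates_le[OF a, of C] True by (auto simp: s_def)
    qed
    then have "solves_KW_mono n f (Answer 0)"
      by (simp add: solves_KW_mono_def)
    from KW[OF this] show ?thesis by simp
  next
    case False
    then show ?thesis
      using KW[OF P(2)] P(1) cardR by (simp add: q_def s_def)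
  qed
qed

theorem theorem1p3:
  "\<exists>c::real. c > 0 \<and>
     (\<forall>n\<ge>1. \<forall>f :: (nat \<Rightarrow> bool) \<Rightarrow> bool.
        mono_on (cube n) f \<longrightarrow> real (EC n f) \<ge> c * real (KW_mono n f))"
proof (intro exI[of _ "1 / 18"] conjI allI impI)
  fix n :: nat and f :: "(nat \<Rightarrow> bool) \<Rightarrow> bool"
  assume n: "n \<ge> 1" and f: "mono_on (cube n) f"
  have "EC n f \<in> EC_circuit n ` {C. is_circuit n C \<and> computes n C f}"
    unfolding EC_def using circuit_exists[OF n, of f] by (intro Inf_nat_def1) auto
  then obtain C where "is_circuit n C" "computes n C f" "EC n f = EC_circuit n C" by auto
  with KW_mono_le_EC_circuit[OF f] have "KW_mono n f \<le> 18 * EC n f" by simp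
  then show "real (EC n f) \<ge> 1 / 18 * real (KW_mono n f)" by simp
qed simp

end
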